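(* Let $A\in\mathbb{R}^{n\times n}$ be totally positive, let $\Delta\in\mathbb{R}^{n\times n}$ be entrywise nonnegative, and let $s=(1,-1,1,-1,\dots)^T\in\mathbb{R}^n$. Then $$r(A,\Delta)=\frac{1}{\rho(|A^{-1}|\Delta)}=\frac{1}{\rho(D_sA^{-1}D_s\Delta)}.$$
   Context: A matrix $A\in\mathbb{R}^{n\times n}$ is totally positive if all its minors are (strictly) positive. $\rho$ denotes the spectral radius, $|M|$ the entrywise absolute value of a matrix $M$, and $D_s$ the diagonal matrix with diagonal $s$. The regularity radius is $r(A,\Delta)=\min\{\delta\ge 0 : [A-\delta\Delta,A+\delta\Delta]\text{ is singular}\}$, with value $\infty$ if no such $\delta$ exists, where $[A-\delta\Delta,A+\delta\Delta]$ is the set of all real matrices $A'$ with $A-\delta\Delta\le A'\le A+\delta\Delta$ entrywise, and this set is called singular if it contains at least one singular matrix. The convention $1/0=\infty$ is used. *)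

theory Defs
  imports
    "Jordan_Normal_Form.DL_Submatrix"
    "Jordan_Normal_Form.Determinant"
    "Jordan_Normal_Form.Gauss_Jordan_Elimination"
    "Jordan_Normal_Form.Spectral_Radius"
    "HOL-Library.Extended_Real"
begin

definition totally_positive :: "real mat \<Rightarrow> bool" where
  "totally_positive A \<longleftrightarrow>
     (\<forall>I J. I \<subseteq> {..<dim_row A} \<longrightarrow> J \<subseteq> {..<dim_col A} \<longrightarrow> I \<noteq> {} \<longrightarrow> card I = card J \<longrightarrow>
        Determinant.det (submatrix A I J) > 0)"

text \<open>The spectrum of a real matrix is taken over the complex numbers.\<close>

definition real_spectral_radius :: "real mat \<Rightarrow> real" where
  "real_spectral_radius M = spectral_radius (map_mat complex_of_real M)"

definition abs_mat :: "real mat \<Rightarrow> real mat" where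
  "abs_mat M = map_mat abs M"

text \<open>\<^const>\<open>mat_inverse\<close> returns \<^const>\<open>None\<close> on non-invertible matrices, for which
  \<open>inv_mat\<close> is unspecified.\<close>

definition inv_mat :: "real mat \<Rightarrow> real mat" where
  "inv_mat A = the (mat_inverse A)"

definition diag_of_vec :: "real vec \<Rightarrow> real mat" where
  "diag_of_vec s = mat_diag (dim_vec s) (\<lambda>i. s $ i)"

text \<open>The order on matrices is entrywise and includes equality of dimensions, so the order
  interval contains only matrices of the dimensions of \<open>\<Delta>\<close>.\<close>

definition interval_mat :: "real mat \<Rightarrow> real \<Rightarrow> real mat \<Rightarrow> real mat set" where
  "interval_mat A \<delta> \<Delta> = {A - \<delta> \<cdot>\<^sub>m \<Delta> .. A + \<delta> \<cdot>\<^sub>m \<Delta>}"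

definition singular_set :: "real mat set \<Rightarrow> bool" where
  "singular_set S \<longleftrightarrow> (\<exists>A' \<in> S. \<not> invertible_mat A')"

text \<open>\<^const>\<open>Least\<close> renders a genuine minimum: its value is unspecified when the minimum is
  not attained.\<close>

definition regularity_radius :: "real mat \<Rightarrow> real mat \<Rightarrow> ereal" where
  "regularity_radius A \<Delta> =
     (if \<exists>\<delta>\<ge>0. singular_set (interval_mat A \<delta> \<Delta>)
      then ereal (LEAST \<delta>. \<delta> \<ge> 0 \<and> singular_set (interval_mat A \<delta> \<Delta>))
      else \<infinity>)"

end

theory Submission
  imports Defs
begin

text \<open>
  Write \<open>C = |A\<inverse>|\<close>, \<open>D = D\<^sub>s\<close> and \<open>\<rho> = \<rho>(C\<Delta>)\<close>. The cofactor formula gives \<open>D A\<inverse> D = C\<close>. If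
  \<open>A'x = 0\<close> with \<open>x \<noteq> 0\<close> and \<open>|A' - A| \<le> \<delta>\<Delta>\<close>, then \<open>x = A\<inverse>(A - A')x\<close> yields \<open>|x| \<le> \<delta>C\<Delta>|x|\<close>, and
  \<open>\<delta>\<rho> \<ge> 1\<close> because \<open>tx \<le> Mx\<close> with \<open>0 \<le> M\<close> and \<open>0 \<le> x \<noteq> 0\<close> forces \<open>t \<le> \<rho>(M)\<close>. Conversely \<open>\<rho>\<close> is an eigenvalue
  of \<open>C\<Delta>\<close>, say \<open>C\<Delta>x = \<rho>x\<close>, and then \<open>A - \<rho>\<inverse> D\<Delta>D\<close> annihilates \<open>Dx\<close>.

  That \<open>\<rho>(M)\<close> is an eigenvalue of a nonnegative \<open>M\<close> is derived without a fixed-point theorem: let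
  \<open>u = |v|\<close> for an eigenvector \<open>v\<close> with eigenvalue of modulus \<open>\<rho>\<close>. For \<open>t > \<rho>\<close> the matrix \<open>tI - M\<close> is inverse-nonnegative,
  and so \<open>(t - \<rho>)(tI - M)\<inverse>u \<ge> u\<close>; were \<open>\<rho>I - M\<close> invertible, the left side would
  tend to \<open>0\<close> as \<open>t\<close> decreases to \<open>\<rho>\<close>.
\<close>

section \<open>Entrywise order\<close>

abbreviation abs_vec :: "real vec \<Rightarrow> real vec" where
  "abs_vec \<equiv> map_vec abs"

lemma mult_mat_vec_index:
  assumes "M \<in> carrier_mat m n" and "x \<in> carrier_vec n" and "i < m"
  shows "(M *\<^sub>v x) $ i = (\<Sum>j<n. M $$ (i,j) * x $ j)"
  using assms by (auto simp: scalar_prod_def atLeast0LessThan intro!: sum.cong)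

lemma mult_mat_index:
  assumes "M \<in> carrier_mat m n" and "N \<in> carrier_mat n p" and "i < m" and "j < p"
  shows "(M * N) $$ (i,j) = (\<Sum>k<n. M $$ (i,k) * N $$ (k,j))"
  using assms by (auto simp: scalar_prod_def atLeast0LessThan intro!: sum.cong)

lemma nonneg_matD:
  assumes "0\<^sub>m m n \<le> M"
  shows "M \<in> carrier_mat m n" and "i < m \<Longrightarrow> j < n \<Longrightarrow> (0::real) \<le> M $$ (i,j)"
  using assms by (auto simp: less_eq_mat_def)

lemma nonneg_vecD:
  assumes "0\<^sub>v n \<le> x"
  shows "x \<in> carrier_vec n" and "i < n \<Longrightarrow> (0::real) \<le> x $ i"
  using assms by (auto simp: less_eq_vec_def)

lemma nonneg_mat_mult:
  fixes M :: "real mat"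
  assumes "0\<^sub>m m n \<le> M" and "0\<^sub>m n p \<le> N"
  shows "0\<^sub>m m p \<le> M * N"
  using nonneg_matD[OF assms(1)] nonneg_matD[OF assms(2)]
  by (auto simp: less_eq_mat_def mult_mat_index simp del: index_mult_mat(1) intro!: sum_nonneg)

lemma nonneg_mat_pow:
  fixes M :: "real mat"
  assumes "0\<^sub>m n n \<le> M"
  shows "0\<^sub>m n n \<le> M ^\<^sub>m k"
proof (induction k)
  case 0
  show ?case using nonneg_matD(1)[OF assms] by (auto simp: less_eq_mat_def)
next
  case (Suc k)
  then show ?case using nonneg_mat_mult[OF _ assms] by simp
qed

lemma nonneg_mat_smult:
  fixes M :: "real mat"
  assumes "0\<^sub>m m n \<le> M" and "0 \<le> c"
  shows "0\<^sub>m m n \<le> c \<cdot>\<^sub>m M"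
  using assms by (auto simp: less_eq_mat_def)

lemma nonneg_abs_mat:
  assumes "M \<in> carrier_mat m n"
  shows "0\<^sub>m m n \<le> abs_mat M"
  using assms by (auto simp: abs_mat_def less_eq_mat_def)

lemma mult_mat_vec_mono:
  fixes M :: "real mat"
  assumes "0\<^sub>m m n \<le> M" and "x \<le> y" and "y \<in> carrier_vec n"
  shows "M *\<^sub>v x \<le> M *\<^sub>v y"
proof -
  note M = nonneg_matD[OF assms(1)]
  have x: "x \<in> carrier_vec n" using assms(2,3) by (auto simp: less_eq_vec_def)
  show ?thesis unfolding less_eq_vec_def
  proof (intro conjI allI impI)
    fix i assume "i < dim_vec (M *\<^sub>v y)"
    hence i: "i < m" using M(1) by auto
    show "(M *\<^sub>v x) $ i \<le> (M *\<^sub>v y) $ i"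
      unfolding mult_mat_vec_index[OF M(1) x i] mult_mat_vec_index[OF M(1) assms(3) i]
      using M(2) i assms(2,3) by (intro sum_mono mult_left_mono) (auto simp: less_eq_vec_def)
  qed auto
qed

lemma abs_mult_mat_vec_le:
  assumes "B \<in> carrier_mat m n" and "x \<in> carrier_vec n"
  shows "abs_vec (B *\<^sub>v x) \<le> abs_mat B *\<^sub>v abs_vec x"
proof -
  have "\<bar>\<Sum>j<n. B $$ (i,j) * x $ j\<bar> \<le> (\<Sum>j<n. \<bar>B $$ (i,j)\<bar> * \<bar>x $ j\<bar>)" for i
    by (rule order_trans[OF sum_abs]) (simp add: abs_mult)
  moreover have "(abs_mat B *\<^sub>v abs_vec x) $ i = (\<Sum>j<n. \<bar>B $$ (i,j)\<bar> * \<bar>x $ j\<bar>)" if "i < m" for i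
    using assms that by (subst mult_mat_vec_index[of _ m n]) (auto simp: abs_mat_def)
  ultimately show ?thesis
    using assms mult_mat_vec_index[OF assms]
    by (auto simp: less_eq_vec_def abs_mat_def simp del: index_mult_mat_vec)
qed

lemma smult_mat_mult_vec:
  fixes M :: "'a :: comm_ring_1 mat"
  assumes "M \<in> carrier_mat m n" and "x \<in> carrier_vec n"
  shows "(c \<cdot>\<^sub>m M) *\<^sub>v x = c \<cdot>\<^sub>v (M *\<^sub>v x)"
  using assms by (intro eq_vecI) auto

lemma smult_vec_mono:
  fixes x y :: "real vec"
  assumes "x \<le> y" and "0 \<le> c"
  shows "c \<cdot>\<^sub>v x \<le> c \<cdot>\<^sub>v y"
  using assms by (auto simp: less_eq_vec_def mult_left_mono)

section \<open>The spectral radius of a nonnegative matrix\<close>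

lemma real_spectral_radius_nonneg:
  assumes "M \<in> carrier_mat n n" and "n \<ge> 1"
  shows "0 \<le> real_spectral_radius M"
  using spectral_radius_mem_max(1)[of "map_mat complex_of_real M" n] assms
  by (auto simp: real_spectral_radius_def)

text \<open>An eigenvalue \<open>k\<close> of \<open>c A\<close> of maximal modulus makes
  \<open>k / c\<close> an eigenvalue of \<open>A\<close>. This serves to scale a matrix until its
  spectral radius drops below 1.\<close>

lemma spectral_radius_smult_le:
  assumes A: "A \<in> carrier_mat n n" and n: "n \<ge> 1" and c: "c \<noteq> 0"
  shows "spectral_radius (c \<cdot>\<^sub>m A) \<le> norm c * spectral_radius A"
proof -
  have cA: "c \<cdot>\<^sub>m A \<in> carrier_mat n n" using A by auto
  obtain k v where k: "norm k = spectral_radius (c \<cdot>\<^sub>m A)"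
    and v: "v \<in> carrier_vec n" "v \<noteq> 0\<^sub>v n" "(c \<cdot>\<^sub>m A) *\<^sub>v v = k \<cdot>\<^sub>v v"
    using spectral_radius_mem_max(1)[OF cA] n A
    by (auto simp: spectrum_def eigenvalue_def eigenvector_def)
  have "c \<cdot>\<^sub>v (A *\<^sub>v v) = k \<cdot>\<^sub>v v" using v smult_mat_mult_vec[OF A v(1)] by simp
  hence "(1 / c) \<cdot>\<^sub>v (c \<cdot>\<^sub>v (A *\<^sub>v v)) = (1 / c) \<cdot>\<^sub>v (k \<cdot>\<^sub>v v)" by simp
  hence "A *\<^sub>v v = (k / c) \<cdot>\<^sub>v v" using c by (simp add: smult_smult_assoc)
  hence "k / c \<in> spectrum A" using v A
    by (auto simp: spectrum_def eigenvalue_def eigenvector_def)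
  hence "norm (k / c) \<le> spectral_radius A" using spectral_radius_mem_max(2)[OF A] n by auto
  thus ?thesis using c k by (simp add: norm_divide field_simps)
qed

text \<open>A Collatz-Wielandt type bound. If \<open>t\<close> exceeded the spectral radius, a
  suitable rescaling of \<open>M\<close> would have bounded powers, while iterating the hypothesis
  makes the same powers grow geometrically on \<open>x\<close>.\<close>

lemma subinvariant_le_spectral_radius:
  assumes M: "0\<^sub>m n n \<le> M" and n: "n \<ge> 1"
    and x: "0\<^sub>v n \<le> x" "x \<noteq> 0\<^sub>v n" and Mx: "t \<cdot>\<^sub>v x \<le> M *\<^sub>v x"
  shows "t \<le> real_spectral_radius M"
proof (rule ccontr)
  let ?\<rho> = "real_spectral_radius M"
  note xc = nonneg_vecD[OF x(1)]
  assume "\<not> t \<le> ?\<rho>"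
  \<comment> \<open>Dividing by a \<open>c\<close> strictly between the two numbers makes the
    spectral radius smaller than 1 and keeps the growth factor \<open>t / c\<close> larger than
    1.\<close>
  then obtain c where c: "?\<rho> < c" "c < t" using dense by (metis not_le)
  have \<rho>0: "0 \<le> ?\<rho>" by (rule real_spectral_radius_nonneg[OF nonneg_matD(1)[OF M] n])
  with c have c0: "0 < c" by simp
  define P where "P = (1 / c) \<cdot>\<^sub>m M"
  have P: "0\<^sub>m n n \<le> P" unfolding P_def using c0 by (intro nonneg_mat_smult[OF M]) auto
  note Pc = nonneg_matD(1)[OF P]
  have "map_mat complex_of_real P = complex_of_real (1 / c) \<cdot>\<^sub>m map_mat complex_of_real M"
    unfolding P_def by (intro eq_matI) auto
  hence "spectral_radius (map_mat complex_of_real P) \<le> norm (complex_of_real (1 / c)) * ?\<rho>"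
    using spectral_radius_smult_le[of "map_mat complex_of_real M" n "complex_of_real (1 / c)"]
      nonneg_matD(1)[OF M] n c0 by (auto simp: real_spectral_radius_def)
  also have "\<dots> < 1" using c c0 by (simp add: norm_divide)
  \<comment> \<open>Spectral radius below 1 bounds the entries of all powers by one constant,
    independent of \<open>k\<close>.\<close>
  finally obtain b where b: "\<And>k. norm_bound (map_mat complex_of_real P ^\<^sub>m k) b"
    using spectral_radius_jnf_norm_bound_less_1_upper_triangular[of "map_mat complex_of_real P" n] Pc
    by auto
  have bound: "(P ^\<^sub>m k) $$ (i,j) \<le> b" if "i < n" "j < n" for i j k
  proof -
    have "map_mat complex_of_real (P ^\<^sub>m k) = map_mat complex_of_real P ^\<^sub>m k"
      by (rule of_real_hom.mat_hom_pow[OF Pc])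
    with b[of k] that Pc have "norm (complex_of_real ((P ^\<^sub>m k) $$ (i,j))) \<le> b"
      unfolding norm_bound_def
      by (metis index_map_mat(1) index_map_mat(2) index_map_mat(3) pow_mat_dim_square(1) pow_mat_dim_square(2))
    thus ?thesis by simp
  qed
  have Px: "(t / c) \<cdot>\<^sub>v x \<le> P *\<^sub>v x"
  proof -
    have "P *\<^sub>v x = (1 / c) \<cdot>\<^sub>v (M *\<^sub>v x)"
      unfolding P_def using nonneg_matD(1)[OF M] xc(1) by (rule smult_mat_mult_vec)
    thus ?thesis using smult_vec_mono[OF Mx, of "1 / c"] c0 by (simp add: smult_smult_assoc)
  qed
  have pow: "(t / c) ^ k \<cdot>\<^sub>v x \<le> P ^\<^sub>m k *\<^sub>v x" for k
  proof (induction k)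
    case 0
    show ?case using Pc xc(1) by simp
  next
    case (Suc k)
    have Pk: "P ^\<^sub>m k \<in> carrier_mat n n" using Pc by auto
    have "(t / c) ^ Suc k \<cdot>\<^sub>v x = (t / c) \<cdot>\<^sub>v ((t / c) ^ k \<cdot>\<^sub>v x)" by (simp add: smult_smult_assoc)
    also have "\<dots> \<le> (t / c) \<cdot>\<^sub>v (P ^\<^sub>m k *\<^sub>v x)" using c c0 by (intro smult_vec_mono Suc) auto
    \<comment> \<open>The scalar moves inside so that \<open>Px\<close> can be applied under the
      nonnegative matrix \<open>P ^\<^sub>m k\<close>; the new factor of the power stands on the
      right.\<close>
    also have "\<dots> = P ^\<^sub>m k *\<^sub>v ((t / c) \<cdot>\<^sub>v x)" using Pk xc(1) by (metis mult_mat_vec)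
    also have "\<dots> \<le> P ^\<^sub>m k *\<^sub>v (P *\<^sub>v x)"
      using Pc xc by (intro mult_mat_vec_mono[OF nonneg_mat_pow[OF P] Px]) auto
    also have "\<dots> = P ^\<^sub>m Suc k *\<^sub>v x" using assoc_mult_mat_vec[OF Pk Pc xc(1)] by simp
    finally show ?case .
  qed
  \<comment> \<open>The growth is observed in a coordinate where \<open>x\<close> is
    positive.\<close>
  obtain i where i: "i < n" "0 < x $ i"
    using x(2) xc by (metis carrier_vecD eq_vecI index_zero_vec order_le_less)
  have le: "(t / c) ^ k * x $ i \<le> b * (\<Sum>j<n. x $ j)" for k
  proof -
    have "(t / c) ^ k * x $ i \<le> (P ^\<^sub>m k *\<^sub>v x) $ i"
      using pow[of k] i xc(1) Pc by (auto simp: less_eq_vec_def simp del: index_mult_mat_vec)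
    also have "\<dots> = (\<Sum>j<n. (P ^\<^sub>m k) $$ (i,j) * x $ j)"
      using Pc xc(1) i by (intro mult_mat_vec_index[of _ n]) auto
    also have "\<dots> \<le> (\<Sum>j<n. b * x $ j)"
      using bound xc i by (intro sum_mono mult_right_mono) auto
    finally show ?thesis by (simp add: sum_distrib_left)
  qed
  have "1 < t / c" using c c0 by simp
  then obtain k where "b * (\<Sum>j<n. x $ j) / x $ i < (t / c) ^ k" using real_arch_pow by blast
  with le[of k] i show False by (simp add: field_simps)
qed

text \<open>The last hypothesis says (tI - M)w \<ge> 0, so this is inverse-nonnegativity of tI - M,
  phrased so that invertibility need not be known beforehand.\<close>

lemma inverse_nonneg_above_spectral_radius:
  assumes M: "0\<^sub>m n n \<le> M" and n: "n \<ge> 1" and t: "real_spectral_radius M < t"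
    and w: "w \<in> carrier_vec n" and Mw: "M *\<^sub>v w \<le> t \<cdot>\<^sub>v w"
  shows "0\<^sub>v n \<le> w"
proof -
  note Mc = nonneg_matD[OF M]
  \<comment> \<open>the negative part of \<open>w\<close> is subinvariant with factor \<open>t\<close>, hence zero\<close>
  define z where "z = vec n (\<lambda>i. max (- w $ i) 0)"
  have zc: "z \<in> carrier_vec n" by (simp add: z_def)
  have t0: "0 \<le> t" using real_spectral_radius_nonneg[OF Mc(1) n] t by simp
  have "t \<cdot>\<^sub>v z \<le> M *\<^sub>v z" unfolding less_eq_vec_def
  proof (intro conjI allI impI)
    show "dim_vec (t \<cdot>\<^sub>v z) = dim_vec (M *\<^sub>v z)" using Mc(1) zc by auto
    fix i assume "i < dim_vec (M *\<^sub>v z)"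
    hence i: "i < n" using Mc(1) by auto
    have Mz: "(M *\<^sub>v z) $ i = (\<Sum>j<n. M $$ (i,j) * z $ j)" by (rule mult_mat_vec_index[OF Mc(1) zc i])
    \<comment> \<open>Since z \<ge> -w, row \<open>i\<close> of \<open>M z\<close> is at least
      -(Mw)_i \<ge> -t w_i; it is also at least 0. One of these two bounds equals t z_i, according
      to the sign of w_i.\<close>
    have "(\<Sum>j<n. M $$ (i,j) * - w $ j) \<le> (\<Sum>j<n. M $$ (i,j) * z $ j)"
      using Mc(2) i by (intro sum_mono mult_left_mono) (auto simp: z_def)
    moreover have "(\<Sum>j<n. M $$ (i,j) * w $ j) \<le> t * w $ i"
      using Mw i w mult_mat_vec_index[OF Mc(1) w i] by (auto simp: less_eq_vec_def)
    ultimately have "- (t * w $ i) \<le> (M *\<^sub>v z) $ i" unfolding Mz by (simp add: sum_negf)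
    moreover have "0 \<le> (M *\<^sub>v z) $ i" unfolding Mz
      using Mc(2) i by (intro sum_nonneg mult_nonneg_nonneg) (auto simp: z_def)
    ultimately show "(t \<cdot>\<^sub>v z) $ i \<le> (M *\<^sub>v z) $ i"
      using i by (simp add: z_def max_def del: index_mult_mat_vec)
  qed
  moreover have "0\<^sub>v n \<le> z" by (auto simp: less_eq_vec_def z_def)
  ultimately have "z = 0\<^sub>v n" using subinvariant_le_spectral_radius[OF M n, of z t] t by fastforce
  hence "0 \<le> w $ i" if "i < n" for i
  proof -
    have "z $ i = 0" using \<open>z = 0\<^sub>v n\<close> that by simp
    thus ?thesis using that by (simp add: z_def max_def split: if_splits)
  qed
  thus ?thesis using w by (auto simp: less_eq_vec_def)
qed

lemma det_nonzero_inverse: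
  assumes A: "A \<in> carrier_mat n n" and d: "det A \<noteq> (0::'a::field)"
  obtains B where "B \<in> carrier_mat n n" "A * B = 1\<^sub>m n" "B * A = 1\<^sub>m n"
  using det_non_zero_imp_unit[OF A d, of b] by (auto simp: Units_def ring_mat_def)

lemma smult_one_minus_mult_vec:
  fixes M :: "real mat"
  assumes M: "M \<in> carrier_mat n n" and w: "w \<in> carrier_vec n"
  shows "(t \<cdot>\<^sub>m 1\<^sub>m n - M) *\<^sub>v w = t \<cdot>\<^sub>v w - M *\<^sub>v w"
proof -
  have "(t \<cdot>\<^sub>m 1\<^sub>m n) *\<^sub>v w = t \<cdot>\<^sub>v (1\<^sub>m n *\<^sub>v w)"
    using smult_mat_mult_vec[of "1\<^sub>m n" n n w t] w by simp
  thus ?thesis using M w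
    by (subst minus_mult_distrib_mat_vec[of _ n n]) auto
qed

text \<open>The weak Perron-Frobenius theorem. The limit t \<rightarrow> \<rho> of the outline is
  replaced by a single t = \<rho> + 1/K, with \<open>K\<close> taken from the entries of the
  supposed inverse of \<rho>I - M.\<close>

lemma spectral_radius_eigenvector:
  assumes M: "0\<^sub>m n n \<le> M" and n: "n \<ge> 1"
  obtains x where "x \<in> carrier_vec n" and "x \<noteq> 0\<^sub>v n"
    and "M *\<^sub>v x = real_spectral_radius M \<cdot>\<^sub>v x"
proof -
  define \<rho> where "\<rho> = real_spectral_radius M"
  note Mc = nonneg_matD[OF M]
  let ?Mc = "map_mat complex_of_real M"
  obtain l v where l: "norm l = \<rho>"
    and v: "v \<in> carrier_vec n" "v \<noteq> 0\<^sub>v n" "?Mc *\<^sub>v v = l \<cdot>\<^sub>v v"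
    using spectral_radius_mem_max(1)[of ?Mc n] n Mc(1)
    by (auto simp: spectrum_def eigenvalue_def eigenvector_def \<rho>_def real_spectral_radius_def)
  define u where "u = vec n (\<lambda>i. norm (v $ i))"
  have uc: "u \<in> carrier_vec n" by (simp add: u_def)
  \<comment> \<open>The triangle inequality in row \<open>i\<close> of the complex eigenvalue
    equation: the moduli satisfy \<rho>u \<le> Mu.\<close>
  have Mu: "\<rho> * u $ i \<le> (M *\<^sub>v u) $ i" if i: "i < n" for i
  proof -
    have "\<rho> * u $ i = norm ((l \<cdot>\<^sub>v v) $ i)" using i v(1) l by (simp add: u_def norm_mult)
    also have "\<dots> = norm (\<Sum>j<n. ?Mc $$ (i,j) * v $ j)"
      unfolding v(3)[symmetric] using Mc(1) v(1) i by (subst mult_mat_vec_index[of _ n n]) auto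
    also have "\<dots> \<le> (\<Sum>j<n. norm (?Mc $$ (i,j) * v $ j))" by (rule norm_sum)
    also have "\<dots> = (\<Sum>j<n. M $$ (i,j) * u $ j)"
      using Mc i by (intro sum.cong) (auto simp: norm_mult u_def)
    finally show ?thesis by (simp only: mult_mat_vec_index[OF Mc(1) uc i])
  qed
  \<comment> \<open>Singularity of this real matrix suffices: a real kernel vector is the desired
    eigenvector.\<close>
  have "det (\<rho> \<cdot>\<^sub>m 1\<^sub>m n - M) = 0"
  proof (rule ccontr)
    assume "det (\<rho> \<cdot>\<^sub>m 1\<^sub>m n - M) \<noteq> 0"
    moreover have Nc: "\<rho> \<cdot>\<^sub>m 1\<^sub>m n - M \<in> carrier_mat n n" using Mc(1) by (intro minus_carrier_mat) auto
    ultimately obtain R where R: "R \<in> carrier_mat n n" "R * (\<rho> \<cdot>\<^sub>m 1\<^sub>m n - M) = 1\<^sub>m n"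
      using det_nonzero_inverse by blast
    \<comment> \<open>\<open>K - 1\<close> bounds the effect of \<open>R\<close> on entry sums: for
      z \<ge> 0 the entries of -Rz sum to at most \<open>K - 1\<close> times the sum of
      \<open>z\<close>. The added 1 makes \<open>K\<close> positive, so that 1/K is a legitimate gap
      t - \<rho>.\<close>
    define K where "K = 1 + (\<Sum>i<n. \<Sum>j<n. \<bar>R $$ (i,j)\<bar>)"
    have K: "0 < K" unfolding K_def by (intro add_pos_nonneg sum_nonneg) auto
    define t where "t = \<rho> + 1 / K"
    have t: "real_spectral_radius M < t" using K by (simp add: t_def \<rho>_def)
    have Tc: "t \<cdot>\<^sub>m 1\<^sub>m n - M \<in> carrier_mat n n" using Mc(1) by (intro minus_carrier_mat) auto
    \<comment> \<open>For a kernel vector \<open>w\<close>, inverse-nonnegativity applies to both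
      \<open>w\<close> and \<open>-w\<close>, which forces w = 0.\<close>
    have "det (t \<cdot>\<^sub>m 1\<^sub>m n - M) \<noteq> 0"
    proof
      assume "det (t \<cdot>\<^sub>m 1\<^sub>m n - M) = 0"
      then obtain w where w: "w \<in> carrier_vec n" "w \<noteq> 0\<^sub>v n" "(t \<cdot>\<^sub>m 1\<^sub>m n - M) *\<^sub>v w = 0\<^sub>v n"
        using det_0_iff_vec_prod_zero[OF Tc] by auto
      have Mw: "(M *\<^sub>v w) $ i = t * w $ i" if "i < n" for i
        using arg_cong[OF w(3)[unfolded smult_one_minus_mult_vec[OF Mc(1) w(1)]], of "\<lambda>x. x $ i"]
          that w(1) Mc(1) by (simp del: index_mult_mat_vec)
      have Mw': "M *\<^sub>v w = t \<cdot>\<^sub>v w" using Mw w(1) Mc(1) by (intro eq_vecI) (auto simp del: index_mult_mat_vec)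
      have "M *\<^sub>v (- w) = t \<cdot>\<^sub>v (- w)"
        using mult_mat_vec[OF Mc(1) w(1), of "-1"] Mw' w(1)
        by (intro eq_vecI) (auto simp del: index_mult_mat_vec simp: smult_vec_def uminus_vec_def)
      hence "0\<^sub>v n \<le> - w"
        using inverse_nonneg_above_spectral_radius[OF M n t, of "- w"] w(1) by simp
      moreover have "0\<^sub>v n \<le> w"
        using inverse_nonneg_above_spectral_radius[OF M n t w(1)] Mw' by simp
      ultimately have "w = 0\<^sub>v n" using w(1)
        by (intro eq_vecI) (auto simp: less_eq_vec_def intro!: antisym)
      with w(2) show False by simp
    qed
    then obtain B where B: "B \<in> carrier_mat n n" "(t \<cdot>\<^sub>m 1\<^sub>m n - M) * B = 1\<^sub>m n"
      using det_nonzero_inverse[OF Tc] by blast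
    define w where "w = B *\<^sub>v u"
    have wc: "w \<in> carrier_vec n" using B uc by (simp add: w_def)
    have "t \<cdot>\<^sub>v w - M *\<^sub>v w = u"
      using smult_one_minus_mult_vec[OF Mc(1) wc, of t] assoc_mult_mat_vec[OF Tc B(1) uc] B(2) uc
      by (simp add: w_def)
    hence Mw: "(M *\<^sub>v w) $ i = t * w $ i - u $ i" if "i < n" for i
    proof -
      have "(t \<cdot>\<^sub>v w - M *\<^sub>v w) $ i = u $ i" using \<open>t \<cdot>\<^sub>v w - M *\<^sub>v w = u\<close> by simp
      thus ?thesis using that wc Mc(1) by (simp del: index_mult_mat_vec)
    qed
    have w0: "0\<^sub>v n \<le> w"
      by (rule inverse_nonneg_above_spectral_radius[OF M n t wc])
        (use Mw wc Mc(1) in \<open>auto simp: less_eq_vec_def u_def simp del: index_mult_mat_vec\<close>)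
    \<comment> \<open>This is (t - \<rho>)w - u with w = (tI - M)^-1 u. It is nonnegative because
      (tI - M)z = Mu - \<rho>u \<ge> 0.\<close>
    define z where "z = (1 / K) \<cdot>\<^sub>v w - u"
    have zc: "z \<in> carrier_vec n" using wc uc by (simp add: z_def)
    have z: "z $ i = w $ i / K - u $ i" if "i < n" for i using that wc uc by (simp add: z_def)
    have "(M *\<^sub>v z) $ i \<le> t * z $ i" if i: "i < n" for i
    proof -
      have "(M *\<^sub>v z) $ i = (\<Sum>j<n. M $$ (i,j) * w $ j) / K - (\<Sum>j<n. M $$ (i,j) * u $ j)"
        unfolding mult_mat_vec_index[OF Mc(1) zc i] sum_divide_distrib sum_subtractf[symmetric]
        using z by (intro sum.cong) (auto simp: right_diff_distrib)
      also have "\<dots> = (t * w $ i - u $ i) / K - (M *\<^sub>v u) $ i"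
        using Mw[OF i] mult_mat_vec_index[OF Mc(1) wc i] mult_mat_vec_index[OF Mc(1) uc i] by simp
      also have "\<dots> \<le> (t * w $ i - u $ i) / K - \<rho> * u $ i" using Mu[OF i] by simp
      also have "\<dots> = t * z $ i" unfolding z[OF i] by (simp add: t_def algebra_simps diff_divide_distrib add_divide_distrib)
      finally show ?thesis .
    qed
    hence z0: "0\<^sub>v n \<le> z"
      using zc Mc(1) by (intro inverse_nonneg_above_spectral_radius[OF M n t zc])
        (auto simp: less_eq_vec_def simp del: index_mult_mat_vec)
    \<comment> \<open>Passing from \<open>t\<close> to \<rho> subtracts w/K from (tI - M)w = u.
      Hence w = -Rz, which bounds \<open>w\<close> in terms of \<open>z\<close>.\<close>
    have "(\<rho> \<cdot>\<^sub>m 1\<^sub>m n - M) *\<^sub>v w = - z"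
      unfolding smult_one_minus_mult_vec[OF Mc(1) wc]
      using wc zc Mc(1) Mw z
      by (intro eq_vecI) (auto simp: t_def distrib_right simp del: index_mult_mat_vec)
    hence "w = R *\<^sub>v (- z)" using R Nc wc
      by (metis assoc_mult_mat_vec one_mult_mat_vec)
    hence w: "w $ i = (\<Sum>j<n. R $$ (i,j) * - z $ j)" if "i < n" for i
      using mult_mat_vec_index[OF R(1) _ that, of "- z"] zc by simp
    have z1: "z $ j \<le> (\<Sum>k<n. z $ k)" if "j < n" for j
      using nonneg_vecD(2)[OF z0] that by (intro member_le_sum) auto
    have "(\<Sum>i<n. w $ i) \<le> (\<Sum>i<n. \<Sum>j<n. \<bar>R $$ (i,j)\<bar> * (\<Sum>k<n. z $ k))"
    proof (intro sum_mono)
      fix i assume "i \<in> {..<n}"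
      hence "w $ i = (\<Sum>j<n. R $$ (i,j) * - z $ j)" using w by simp
      also have "\<dots> \<le> (\<Sum>j<n. \<bar>R $$ (i,j)\<bar> * (\<Sum>k<n. z $ k))"
      proof (intro sum_mono)
        fix j assume "j \<in> {..<n}"
        hence "R $$ (i,j) * - z $ j \<le> \<bar>R $$ (i,j)\<bar> * z $ j"
          using nonneg_vecD(2)[OF z0, of j] by (simp add: abs_if mult_right_mono)
        also have "\<dots> \<le> \<bar>R $$ (i,j)\<bar> * (\<Sum>k<n. z $ k)"
          using z1 \<open>j \<in> {..<n}\<close> by (intro mult_left_mono) auto
        finally show "R $$ (i,j) * - z $ j \<le> \<bar>R $$ (i,j)\<bar> * (\<Sum>k<n. z $ k)" .
      qed
      finally show "w $ i \<le> (\<Sum>j<n. \<bar>R $$ (i,j)\<bar> * (\<Sum>k<n. z $ k))" .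
    qed
    also have "\<dots> = (K - 1) * (\<Sum>k<n. z $ k)" by (simp add: K_def sum_distrib_right)
    also have "\<dots> \<le> K * (\<Sum>k<n. z $ k)"
      using nonneg_vecD(2)[OF z0] by (intro mult_right_mono sum_nonneg) auto
    \<comment> \<open>With W, Z, U the entry sums of \<open>w\<close>, \<open>z\<close>,
      \<open>u\<close>, the bound W \<le> KZ turns into W \<le> W - KU, so U \<le> 0. As u \<ge> 0,
      this gives u = 0 and then v = 0.\<close>
    also have "(\<Sum>k<n. z $ k) = (\<Sum>k<n. w $ k) / K - (\<Sum>k<n. u $ k)"
      unfolding sum_divide_distrib sum_subtractf[symmetric] using z by (intro sum.cong) auto
    finally have "K * (\<Sum>k<n. u $ k) \<le> 0" using K by (simp add: right_diff_distrib)
    hence "(\<Sum>k<n. u $ k) \<le> 0" using K by (simp add: mult_le_0_iff)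
    hence "(\<Sum>k<n. u $ k) = 0" by (intro antisym sum_nonneg) (auto simp: u_def)
    hence "\<forall>k<n. u $ k = 0" by (subst (asm) sum_nonneg_eq_0_iff) (auto simp: u_def)
    hence "v = 0\<^sub>v n" using v(1) by (intro eq_vecI) (auto simp: u_def)
    with v(2) show False by simp
  qed
  then obtain x where x: "x \<in> carrier_vec n" "x \<noteq> 0\<^sub>v n" "(\<rho> \<cdot>\<^sub>m 1\<^sub>m n - M) *\<^sub>v x = 0\<^sub>v n"
    using det_0_iff_vec_prod_zero[of "\<rho> \<cdot>\<^sub>m 1\<^sub>m n - M" n] Mc(1) minus_carrier_mat[OF Mc(1)] by auto
  have "(M *\<^sub>v x) $ i = \<rho> * x $ i" if "i < n" for i
    using arg_cong[OF x(3)[unfolded smult_one_minus_mult_vec[OF Mc(1) x(1)]], of "\<lambda>x. x $ i"]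
      that x(1) Mc(1) by (simp del: index_mult_mat_vec)
  hence "M *\<^sub>v x = \<rho> \<cdot>\<^sub>v x" using x(1) Mc(1) by (intro eq_vecI) (auto simp del: index_mult_mat_vec)
  with x(1,2) that show ?thesis by (simp add: \<rho>_def)
qed

section \<open>The inverse of a totally positive matrix\<close>

lemma inv_mat_inverse:
  assumes A: "A \<in> carrier_mat n n" and d: "det A \<noteq> 0"
  shows "inv_mat A \<in> carrier_mat n n" and "A * inv_mat A = 1\<^sub>m n" and "inv_mat A * A = 1\<^sub>m n"
proof -
  obtain B where "mat_inverse A = Some B"
    using mat_inverse(1)[OF A, of undefined] det_non_zero_imp_unit[OF A d, of undefined]
    by (cases "mat_inverse A") auto
  thus "inv_mat A \<in> carrier_mat n n" "A * inv_mat A = 1\<^sub>m n" "inv_mat A * A = 1\<^sub>m n"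
    using mat_inverse(2)[OF A] by (auto simp: inv_mat_def)
qed

text \<open>Multiply A adj(A) = det(A) I by the inverse from the left; the adjugate transposes,
  hence the swapped indices of the cofactor.\<close>

lemma inv_mat_index_cofactor:
  assumes A: "A \<in> carrier_mat n n" and d: "det A \<noteq> 0" and ij: "i < n" "j < n"
  shows "inv_mat A $$ (i,j) = cofactor A j i / det A"
proof -
  note I = inv_mat_inverse[OF A d]
  note J = adj_mat[OF A]
  have "adj_mat A = (inv_mat A * A) * adj_mat A" using I J by simp
  also have "\<dots> = inv_mat A * (A * adj_mat A)" using I J A by (intro assoc_mult_mat) auto
  also have "\<dots> = det A \<cdot>\<^sub>m inv_mat A" unfolding J(2)
    using I by (subst mult_smult_distrib[of _ n n _ n]) auto
  finally have "adj_mat A $$ (i,j) = det A * inv_mat A $$ (i,j)" using I ij by auto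
  thus ?thesis using d A ij by (simp add: adj_mat_def)
qed

text \<open>A member of a set is the \<open>k\<close>-th pick when exactly \<open>k\<close> members
  lie below it; beyond the removed index the count lags by one.\<close>

lemma pick_delete:
  assumes "i < n" and "k < n - 1"
  shows "pick ({..<n} - {i}) k = (if k < i then k else Suc k)"
proof -
  let ?m = "if k < i then k else Suc k"
  have "{a \<in> {..<n} - {i}. a < ?m} = (if k < i then {..<k} else {..<Suc k} - {i})"
    using assms by auto
  hence "card {a \<in> {..<n} - {i}. a < ?m} = k" by auto
  moreover have "?m \<in> {..<n} - {i}" using assms by auto
  ultimately show ?thesis using pick_card_in_set[of ?m "{..<n} - {i}"] by simp
qed

text \<open>Turns the minors inside cofactors into minors in the sense of
  \<open>totally_positive\<close>.\<close>

lemma mat_delete_eq_submatrix: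
  assumes A: "A \<in> carrier_mat n n" and i: "i < n" and j: "j < n"
  shows "mat_delete A i j = submatrix A ({..<n} - {i}) ({..<n} - {j})"
proof -
  have "card {k. k < n \<and> k \<in> {..<n} - {l}} = n - 1" if "l < n" for l
  proof -
    have "{k. k < n \<and> k \<in> {..<n} - {l}} = {..<n} - {l}" by auto
    thus ?thesis using that by simp
  qed
  thus ?thesis using A i j
    by (intro eq_matI) (simp_all add: mat_delete_def submatrix_def pick_delete)
qed

lemma submatrix_full:
  assumes "A \<in> carrier_mat m n"
  shows "submatrix A {..<m} {..<n} = A"
proof -
  have "pick {..<p} k = k" if "k < p" for k p :: nat
  proof -
    have "{a \<in> {..<p}. a < k} = {..<k}" using that by auto
    thus ?thesis using pick_card_in_set[of k "{..<p}"] that by simp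
  qed
  moreover have "{i. i < p \<and> i \<in> {..<p}} = {..<p}" for p :: nat by auto
  ultimately show ?thesis using assms by (intro eq_matI) (auto simp: submatrix_def)
qed

lemma totally_positive_det:
  assumes A: "A \<in> carrier_mat n n" and tp: "totally_positive A" and n: "n \<ge> 1"
  shows "det A > 0"
proof -
  have "det (submatrix A {..<n} {..<n}) > 0"
    using tp A n unfolding totally_positive_def by (auto simp: lessThan_empty_iff)
  thus ?thesis using submatrix_full[OF A] by simp
qed

lemma totally_positive_det_delete:
  assumes A: "A \<in> carrier_mat n n" and tp: "totally_positive A" and i: "i < n" and j: "j < n"
  shows "det (mat_delete A i j) > 0"
proof (cases "n = 1")
  \<comment> \<open>Here the index sets are empty, a case that \<open>totally_positive\<close>
    leaves out; the determinant of the 0 by 0 matrix is 1.\<close>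
  case True
  hence "mat_delete A i j \<in> carrier_mat 0 0" using A by (auto simp: mat_delete_def)
  thus ?thesis by (simp add: det_dim_zero)
next
  case False
  have "{..<n} - {i} \<noteq> {}"
  proof
    assume "{..<n} - {i} = {}"
    hence "card {..<n} \<le> card {i}" by (intro card_mono) auto
    thus False using False i by simp
  qed
  moreover have "card ({..<n} - {i}) = card ({..<n} - {j})" using i j by simp
  ultimately show ?thesis
    unfolding mat_delete_eq_submatrix[OF A i j]
    using tp A unfolding totally_positive_def by auto
qed

text \<open>Entry (i,j) of the inverse is (-1)^(i+j) times a quotient of positive determinants.
  Conjugation by \<open>D\<close> supplies the same sign once more, so both sides equal that
  quotient.\<close>

lemma totally_positive_signed_inverse:
  assumes A: "A \<in> carrier_mat n n" and tp: "totally_positive A" and n: "n \<ge> 1"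
  defines "D \<equiv> diag_of_vec (vec n (\<lambda>i. (-1) ^ i))"
  shows "D * inv_mat A * D = abs_mat (inv_mat A)"
proof -
  have d: "det A > 0" by (rule totally_positive_det[OF A tp n])
  note I = inv_mat_inverse[OF A]
  have D: "D = mat_diag n (\<lambda>i. (-1) ^ i)"
    unfolding D_def diag_of_vec_def by (intro eq_matI) (auto simp: mat_diag_def)
  have Ic: "inv_mat A \<in> carrier_mat n n" using I d by simp
  have "D * inv_mat A * D = mat n n (\<lambda>(i,j). (-1) ^ i * inv_mat A $$ (i,j) * (-1) ^ j)"
    unfolding D using Ic
    by (subst mat_diag_mult_left[OF Ic], subst mat_diag_mult_right[of _ n]) (auto intro!: eq_matI)
  also have "\<dots> = abs_mat (inv_mat A)"
  proof (intro eq_matI)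
    fix i j assume "i < dim_row (abs_mat (inv_mat A))" "j < dim_col (abs_mat (inv_mat A))"
    hence ij: "i < n" "j < n" using Ic by (auto simp: abs_mat_def)
    have e: "inv_mat A $$ (i,j) = (-1) ^ (i + j) * (det (mat_delete A j i) / det A)"
      using inv_mat_index_cofactor[OF A _ ij] d by (simp add: cofactor_def add.commute)
    have "(-1) ^ i * inv_mat A $$ (i,j) * (-1) ^ j = det (mat_delete A j i) / det A"
      unfolding e by (simp add: power_add flip: power_mult_distrib)
    moreover have "\<bar>inv_mat A $$ (i,j)\<bar> = det (mat_delete A j i) / det A"
      unfolding e using totally_positive_det_delete[OF A tp ij(2,1)] d by (simp add: abs_mult power_abs)
    ultimately show "mat n n (\<lambda>(i,j). (-1) ^ i * inv_mat A $$ (i,j) * (-1) ^ j) $$ (i,j)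
        = abs_mat (inv_mat A) $$ (i,j)"
      using ij Ic by (simp add: abs_mat_def)
  qed (use Ic in \<open>auto simp: abs_mat_def\<close>)
  finally show ?thesis .
qed

section \<open>The regularity radius\<close>

lemma invertible_mat_iff_det:
  assumes A: "(A :: 'a :: field mat) \<in> carrier_mat n n"
  shows "invertible_mat A \<longleftrightarrow> det A \<noteq> 0"
proof
  assume "invertible_mat A"
  then obtain B where B: "A * B = 1\<^sub>m n" "B * A = 1\<^sub>m (dim_row B)"
    using A by (auto simp: invertible_mat_def inverts_mat_def)
  \<comment> \<open>\<open>invertible_mat\<close> does not fix the dimensions of the inverse;
    comparing column counts in the two products recovers them.\<close>
  have "B \<in> carrier_mat n n"
    using arg_cong[OF B(1), of dim_col] arg_cong[OF B(2), of dim_col] A by auto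
  hence "det A * det B = 1" using det_mult[OF A] B(1) by (metis det_one)
  thus "det A \<noteq> 0" by auto
next
  assume "det A \<noteq> 0"
  then obtain B where "B \<in> carrier_mat n n" "A * B = 1\<^sub>m n" "B * A = 1\<^sub>m n"
    using det_nonzero_inverse[OF A] by blast
  thus "invertible_mat A" using A by (auto simp: invertible_mat_def inverts_mat_def)
qed

lemma interval_mat_iff:
  assumes "A \<in> carrier_mat m n" and "\<Delta> \<in> carrier_mat m n"
  shows "A' \<in> interval_mat A \<delta> \<Delta> \<longleftrightarrow>
    A' \<in> carrier_mat m n \<and> (\<forall>i<m. \<forall>j<n. \<bar>A $$ (i,j) - A' $$ (i,j)\<bar> \<le> \<delta> * \<Delta> $$ (i,j))"
  using assms by (auto simp: interval_mat_def less_eq_mat_def abs_le_iff) (smt (verit))+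

text \<open>Excludes all radii below 1/\<rho>. The product form also covers \<rho> = 0, where it
  says that no radius yields a singular matrix.\<close>

lemma singular_interval_bound:
  assumes A: "A \<in> carrier_mat n n" and dA: "det A \<noteq> 0" and n: "n \<ge> 1"
    and \<Delta>: "0\<^sub>m n n \<le> \<Delta>" and \<delta>: "\<delta> \<ge> 0" and sing: "singular_set (interval_mat A \<delta> \<Delta>)"
  shows "\<delta> * real_spectral_radius (abs_mat (inv_mat A) * \<Delta>) \<ge> 1"
proof -
  note \<Delta>c = nonneg_matD(1)[OF \<Delta>]
  note I = inv_mat_inverse[OF A dA]
  have C: "0\<^sub>m n n \<le> abs_mat (inv_mat A)" by (rule nonneg_abs_mat[OF I(1)])
  note Cc = nonneg_matD(1)[OF C]
  define M where "M = abs_mat (inv_mat A) * \<Delta>"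
  have M: "0\<^sub>m n n \<le> M" unfolding M_def by (rule nonneg_mat_mult[OF C \<Delta>])
  obtain A' where A': "A' \<in> carrier_mat n n"
      "\<And>i j. i < n \<Longrightarrow> j < n \<Longrightarrow> \<bar>A $$ (i,j) - A' $$ (i,j)\<bar> \<le> \<delta> * \<Delta> $$ (i,j)"
      "\<not> invertible_mat A'"
    using sing interval_mat_iff[OF A \<Delta>c] by (auto simp: singular_set_def)
  then obtain x where x: "x \<in> carrier_vec n" "x \<noteq> 0\<^sub>v n" "A' *\<^sub>v x = 0\<^sub>v n"
    using invertible_mat_iff_det[OF A'(1)] det_0_iff_vec_prod_zero[OF A'(1)] by auto
  define y where "y = abs_vec x"
  have y: "0\<^sub>v n \<le> y" "y \<noteq> 0\<^sub>v n"
  proof -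
    show "0\<^sub>v n \<le> y" using x(1) by (auto simp: y_def less_eq_vec_def)
    have "x = 0\<^sub>v n" if "y = 0\<^sub>v n"
    proof (intro eq_vecI)
      fix i assume "i < dim_vec (0\<^sub>v n :: real vec)"
      hence i: "i < n" by simp
      hence "y $ i = 0" using that by simp
      thus "x $ i = 0\<^sub>v n $ i" using i x(1) by (simp add: y_def)
    qed (use x(1) in simp)
    thus "y \<noteq> 0\<^sub>v n" using x(2) by auto
  qed
  note yc = nonneg_vecD(1)[OF y(1)]
  \<comment> \<open>As A'x = 0, the kernel vector is x = A^-1 (A - A')x; taking moduli turns this
    into y \<le> \<delta>My.\<close>
  have "A *\<^sub>v x = (A - A') *\<^sub>v x"
    using minus_mult_distrib_mat_vec[OF A A'(1) x(1)] x(3) A x(1) by simp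
  moreover have "inv_mat A *\<^sub>v (A *\<^sub>v x) = x"
    using I A x(1) by (simp flip: assoc_mult_mat_vec)
  ultimately have "y = abs_vec (inv_mat A *\<^sub>v ((A - A') *\<^sub>v x))" by (simp add: y_def)
  also have "\<dots> \<le> abs_mat (inv_mat A) *\<^sub>v abs_vec ((A - A') *\<^sub>v x)"
    by (intro abs_mult_mat_vec_le[OF I(1)] mult_mat_vec_carrier[OF minus_carrier_mat[OF A'(1)] x(1)])
  also have "\<dots> \<le> abs_mat (inv_mat A) *\<^sub>v ((\<delta> \<cdot>\<^sub>m \<Delta>) *\<^sub>v y)"
  proof (rule mult_mat_vec_mono[OF C])
    have "abs_vec ((A - A') *\<^sub>v x) \<le> abs_mat (A - A') *\<^sub>v y"
      unfolding y_def using minus_carrier_mat[OF A'(1)] x(1) by (rule abs_mult_mat_vec_le)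
    also have "\<dots> \<le> (\<delta> \<cdot>\<^sub>m \<Delta>) *\<^sub>v y" unfolding less_eq_vec_def
    proof (intro conjI allI impI)
      show "dim_vec (abs_mat (A - A') *\<^sub>v y) = dim_vec ((\<delta> \<cdot>\<^sub>m \<Delta>) *\<^sub>v y)"
        using A'(1) \<Delta>c by (auto simp: abs_mat_def)
      fix i assume "i < dim_vec ((\<delta> \<cdot>\<^sub>m \<Delta>) *\<^sub>v y)"
      hence i: "i < n" using \<Delta>c by auto
      have "(abs_mat (A - A') *\<^sub>v y) $ i = (\<Sum>j<n. \<bar>A $$ (i,j) - A' $$ (i,j)\<bar> * y $ j)"
        using A A'(1) yc i by (subst mult_mat_vec_index[of _ n n]) (auto simp: abs_mat_def)
      also have "\<dots> \<le> (\<Sum>j<n. (\<delta> * \<Delta> $$ (i,j)) * y $ j)"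
        using A'(2) i nonneg_vecD(2)[OF y(1)] by (intro sum_mono mult_right_mono) auto
      also have "\<dots> = ((\<delta> \<cdot>\<^sub>m \<Delta>) *\<^sub>v y) $ i"
        using \<Delta>c yc i by (subst mult_mat_vec_index[of _ n n]) auto
      finally show "(abs_mat (A - A') *\<^sub>v y) $ i \<le> ((\<delta> \<cdot>\<^sub>m \<Delta>) *\<^sub>v y) $ i" .
    qed
    finally show "abs_vec ((A - A') *\<^sub>v x) \<le> (\<delta> \<cdot>\<^sub>m \<Delta>) *\<^sub>v y" .
    show "(\<delta> \<cdot>\<^sub>m \<Delta>) *\<^sub>v y \<in> carrier_vec n" using \<Delta>c yc
      by (intro mult_mat_vec_carrier[of _ n n]) auto
  qed
  also have "\<dots> = \<delta> \<cdot>\<^sub>v (M *\<^sub>v y)"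
  proof -
    have "(\<delta> \<cdot>\<^sub>m \<Delta>) *\<^sub>v y = \<delta> \<cdot>\<^sub>v (\<Delta> *\<^sub>v y)" using \<Delta>c yc by (rule smult_mat_mult_vec)
    moreover have "abs_mat (inv_mat A) *\<^sub>v (\<delta> \<cdot>\<^sub>v (\<Delta> *\<^sub>v y)) = \<delta> \<cdot>\<^sub>v (abs_mat (inv_mat A) *\<^sub>v (\<Delta> *\<^sub>v y))"
      using Cc \<Delta>c yc by (intro mult_mat_vec) auto
    ultimately show ?thesis
      unfolding M_def using assoc_mult_mat_vec[OF Cc \<Delta>c yc] by simp
  qed
  finally have le: "y \<le> \<delta> \<cdot>\<^sub>v (M *\<^sub>v y)" .
  \<comment> \<open>\<delta> = 0 would give y \<le> 0; excluding it permits division by \<delta>,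
    after which \<open>y\<close> is subinvariant with factor 1/\<delta>.\<close>
  have "\<delta> \<noteq> 0"
  proof
    assume "\<delta> = 0"
    hence "y = 0\<^sub>v n" using le y(1) yc nonneg_matD(1)[OF M]
      by (intro eq_vecI) (auto simp: less_eq_vec_def intro!: antisym)
    with y(2) show False by simp
  qed
  with \<delta> have \<delta>: "\<delta> > 0" by simp
  have "(1 / \<delta>) \<cdot>\<^sub>v y \<le> M *\<^sub>v y"
    using smult_vec_mono[OF le, of "1 / \<delta>"] \<delta> by (simp add: smult_smult_assoc)
  hence "1 / \<delta> \<le> real_spectral_radius M"
    by (rule subinvariant_le_spectral_radius[OF M n y])
  thus ?thesis using \<delta> by (simp add: M_def field_simps)
qed

text \<open>Total positivity lets one sign pattern \<open>D\<close> serve for the whole inverse: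
  |A^-1| = D A^-1 D turns the eigenvector equation into a kernel equation for a perturbation of
  \<open>A\<close>.\<close>

lemma singular_interval_attained:
  assumes A: "A \<in> carrier_mat n n" and tp: "totally_positive A" and n: "n \<ge> 1"
    and \<Delta>: "0\<^sub>m n n \<le> \<Delta>"
    and \<rho>: "real_spectral_radius (abs_mat (inv_mat A) * \<Delta>) > 0" (is "?\<rho> > 0")
  shows "singular_set (interval_mat A (1 / ?\<rho>) \<Delta>)"
proof -
  have dA: "det A \<noteq> 0" using totally_positive_det[OF A tp n] by simp
  note \<Delta>c = nonneg_matD[OF \<Delta>]
  note I = inv_mat_inverse[OF A dA]
  define D where "D = diag_of_vec (vec n (\<lambda>i. (-1::real) ^ i))"
  have D': "D = mat_diag n (\<lambda>i. (-1) ^ i)"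
    unfolding D_def diag_of_vec_def by (intro eq_matI) (auto simp: mat_diag_def)
  have Dc: "D \<in> carrier_mat n n" unfolding D' by simp
  have DD: "D * D = 1\<^sub>m n"
    unfolding D' mat_diag_diag by (intro eq_matI) (auto simp: mat_diag_def simp flip: power_mult_distrib)
  have DID: "abs_mat (inv_mat A) = D * inv_mat A * D"
    using totally_positive_signed_inverse[OF A tp n] by (simp add: D_def)
  have M: "0\<^sub>m n n \<le> abs_mat (inv_mat A) * \<Delta>"
    by (intro nonneg_mat_mult[OF _ \<Delta>] nonneg_abs_mat I)
  obtain x where x: "x \<in> carrier_vec n" "x \<noteq> 0\<^sub>v n" "(abs_mat (inv_mat A) * \<Delta>) *\<^sub>v x = ?\<rho> \<cdot>\<^sub>v x"
    using spectral_radius_eigenvector[OF M n] by blast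
  define y where "y = D *\<^sub>v x"
  have yc: "y \<in> carrier_vec n" using Dc x(1) by (simp add: y_def)
  have Dy: "D *\<^sub>v y = x" unfolding y_def using Dc x(1) DD by (simp flip: assoc_mult_mat_vec)
  \<comment> \<open>Chosen because (D\<Delta>D)y = D\<Delta>x. The eigenvector equation, cleared of
    \<open>D\<close> and of the inverse, becomes w = \<rho>Ay.\<close>
  define w where "w = D *\<^sub>v (\<Delta> *\<^sub>v x)"
  have wc: "w \<in> carrier_vec n" using Dc \<Delta>c x(1) by (simp add: w_def)
  have "D *\<^sub>v (inv_mat A *\<^sub>v w) = ?\<rho> \<cdot>\<^sub>v x"
  proof -
    have "(abs_mat (inv_mat A) * \<Delta>) *\<^sub>v x = (D * inv_mat A * D) *\<^sub>v (\<Delta> *\<^sub>v x)"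
      unfolding DID using Dc I(1) \<Delta>c(1) x(1) by (intro assoc_mult_mat_vec) auto
    also have "\<dots> = (D * inv_mat A) *\<^sub>v w"
      unfolding w_def using Dc I(1) \<Delta>c(1) x(1) by (intro assoc_mult_mat_vec) auto
    also have "\<dots> = D *\<^sub>v (inv_mat A *\<^sub>v w)"
      using Dc I(1) wc by (intro assoc_mult_mat_vec) auto
    finally show ?thesis using x(3) by simp
  qed
  hence "D *\<^sub>v (D *\<^sub>v (inv_mat A *\<^sub>v w)) = D *\<^sub>v (?\<rho> \<cdot>\<^sub>v x)" by simp
  moreover have "D *\<^sub>v (?\<rho> \<cdot>\<^sub>v x) = ?\<rho> \<cdot>\<^sub>v y" unfolding y_def using Dc x(1) by (rule mult_mat_vec)
  moreover have "D *\<^sub>v (D *\<^sub>v (inv_mat A *\<^sub>v w)) = inv_mat A *\<^sub>v w"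
  proof -
    have c: "inv_mat A *\<^sub>v w \<in> carrier_vec n" using I(1) wc by auto
    show ?thesis using assoc_mult_mat_vec[OF Dc Dc c] DD c by simp
  qed
  ultimately have "A *\<^sub>v (inv_mat A *\<^sub>v w) = A *\<^sub>v (?\<rho> \<cdot>\<^sub>v y)" by simp
  moreover have "A *\<^sub>v (inv_mat A *\<^sub>v w) = w" using assoc_mult_mat_vec[OF A I(1) wc] I wc by simp
  moreover have "A *\<^sub>v (?\<rho> \<cdot>\<^sub>v y) = ?\<rho> \<cdot>\<^sub>v (A *\<^sub>v y)" by (rule mult_mat_vec[OF A yc])
  ultimately have w: "w = ?\<rho> \<cdot>\<^sub>v (A *\<^sub>v y)" by simp
  define E where "E = D * \<Delta> * D"
  have Ec: "E \<in> carrier_mat n n" using Dc \<Delta>c(1) by (simp add: E_def)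
  have Ei: "E $$ (i,j) = (-1) ^ i * \<Delta> $$ (i,j) * (-1) ^ j" if "i < n" "j < n" for i j
    unfolding E_def D' using that \<Delta>c(1)
    by (subst mat_diag_mult_left[OF \<Delta>c(1)], subst mat_diag_mult_right[of _ n]) auto
  define A' where "A' = A - (1 / ?\<rho>) \<cdot>\<^sub>m E"
  have A'c: "A' \<in> carrier_mat n n" unfolding A'_def using Ec by (intro minus_carrier_mat) auto
  have "E *\<^sub>v y = w"
  proof -
    have "E *\<^sub>v y = (D * \<Delta>) *\<^sub>v (D *\<^sub>v y)"
      unfolding E_def using Dc \<Delta>c(1) yc by (intro assoc_mult_mat_vec) auto
    thus ?thesis unfolding Dy w_def using assoc_mult_mat_vec[OF Dc \<Delta>c(1) x(1)] by simp
  qed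
  hence "((1 / ?\<rho>) \<cdot>\<^sub>m E) *\<^sub>v y = (1 / ?\<rho>) \<cdot>\<^sub>v w"
    using smult_mat_mult_vec[OF Ec yc] by simp
  also have "\<dots> = A *\<^sub>v y" unfolding w using \<rho> by (simp add: smult_smult_assoc)
  finally have "A' *\<^sub>v y = 0\<^sub>v n"
    unfolding A'_def using minus_mult_distrib_mat_vec[of A n n "(1 / ?\<rho>) \<cdot>\<^sub>m E" y] A Ec yc by auto
  moreover have "y \<noteq> 0\<^sub>v n"
  proof
    assume "y = 0\<^sub>v n"
    moreover have "D *\<^sub>v 0\<^sub>v n = 0\<^sub>v n" using Dc by (intro eq_vecI) auto
    ultimately have "x = 0\<^sub>v n" using Dy by simp
    with x(2) show False by simp
  qed
  ultimately have "\<not> invertible_mat A'"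
    using invertible_mat_iff_det[OF A'c] det_0_iff_vec_prod_zero[OF A'c] yc by auto
  \<comment> \<open>Each entry of \<open>E\<close> is the entry of \<open>\<Delta>\<close> up to
    sign, so every entry of A' sits at an end of its interval.\<close>
  moreover have "A' \<in> interval_mat A (1 / ?\<rho>) \<Delta>"
    unfolding interval_mat_iff[OF A \<Delta>c(1)]
    using A'c A Ec Ei \<rho> \<Delta>c(2) by (auto simp: A'_def abs_mult power_abs)
  ultimately show ?thesis by (auto simp: singular_set_def)
qed

theorem mainTheorem8:
  fixes n :: nat and A \<Delta> :: "real mat" and s :: "real vec"
  assumes "n \<ge> 1"
    and "A \<in> carrier_mat n n" and "totally_positive A"
    and "\<Delta> \<in> carrier_mat n n" and "0\<^sub>m n n \<le> \<Delta>"
    and "s = vec n (\<lambda>i. (-1) ^ i)"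
  shows "regularity_radius A \<Delta> = 1 / ereal (real_spectral_radius (abs_mat (inv_mat A) * \<Delta>)) \<and>
    1 / ereal (real_spectral_radius (abs_mat (inv_mat A) * \<Delta>)) =
      1 / ereal (real_spectral_radius (diag_of_vec s * inv_mat A * diag_of_vec s * \<Delta>))"
proof
  let ?\<rho> = "real_spectral_radius (abs_mat (inv_mat A) * \<Delta>)"
  let ?S = "\<lambda>\<delta>. singular_set (interval_mat A \<delta> \<Delta>)"
  have dA: "det A \<noteq> 0" using totally_positive_det[OF assms(2,3,1)] by simp
  have "abs_mat (inv_mat A) * \<Delta> \<in> carrier_mat n n"
    using inv_mat_inverse(1)[OF assms(2) dA] assms(4) by (simp add: abs_mat_def)
  hence \<rho>0: "0 \<le> ?\<rho>" using assms(1) by (rule real_spectral_radius_nonneg)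
  have lower: "1 \<le> \<delta> * ?\<rho>" if "\<delta> \<ge> 0" "?S \<delta>" for \<delta>
    using singular_interval_bound[OF assms(2) dA assms(1,5) that] .
  show "regularity_radius A \<Delta> = 1 / ereal ?\<rho>"
  proof (cases "?\<rho> = 0")
    case True
    \<comment> \<open>The bound would read 1 \<le> 0. The radius is therefore infinite, in agreement
      with 1/0 = \<infinity> in \<open>ereal\<close>.\<close>
    hence "\<not> (\<exists>\<delta>\<ge>0. ?S \<delta>)" using lower by fastforce
    hence "regularity_radius A \<Delta> = \<infinity>" unfolding regularity_radius_def by (rule if_not_P)
    thus ?thesis using True by (simp add: divide_ereal_def flip: zero_ereal_def)
  next
    case False
    with \<rho>0 have \<rho>: "?\<rho> > 0" by simp
    have attained: "?S (1 / ?\<rho>)" by (rule singular_interval_attained[OF assms(2,3,1,5) \<rho>])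
    \<comment> \<open>1/\<rho> is admissible and, by \<open>lower\<close>, below every admissible
      radius, so the minimum exists and \<open>Least\<close> has its intended value.\<close>
    have "(LEAST \<delta>. \<delta> \<ge> 0 \<and> ?S \<delta>) = 1 / ?\<rho>"
      using attained \<rho> lower by (intro Least_equality) (auto simp: field_simps)
    moreover have "\<exists>\<delta>\<ge>0. ?S \<delta>" using attained \<rho> by (intro exI[of _ "1 / ?\<rho>"]) auto
    ultimately show ?thesis using \<rho> by (simp add: regularity_radius_def one_ereal_def)
  qed
  show "1 / ereal ?\<rho> = 1 / ereal (real_spectral_radius (diag_of_vec s * inv_mat A * diag_of_vec s * \<Delta>))"
    using totally_positive_signed_inverse[OF assms(2,3,1)] assms(6) by simp
qed

end
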